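(* Let $k\ge 1$ and $\ell\ge 0$ be integers. Let $X=\{x_1,\dots,x_{k+1}\}$, $Y=\{y_1,\dots,y_{k+1}\}$, $Z=\{z_1,\dots,z_{k+1}\}$ be sets of $k+1$ vertices each, let $A_1,A_2,A_3$ be sets of $k+2$ vertices each, and let $B_1,B_2$ be sets of $\ell$ vertices each, all these sets being pairwise disjoint. Let $\mathcal{H}$ be the hypergraph whose vertex set is the union of these eight sets and whose edges are, for $1\le i\le k+1$, $$A_1\cup B_1\cup\{x_i\}\cup A_2,\qquad A_2\cup B_1\cup\{z_i\}\cup A_3,\qquad A_1\cup B_2\cup\{y_i\}\cup A_3.$$ Then $\mathcal{H}$ is an $r$-uniform hypergraph with $r=5+2k+\ell$ and has $n=9+6k+2\ell$ vertices, and $$\gamma_p^k(\mathcal{H})\ \ge\ 2\ >\ \frac{9+6k+2\ell}{5+3k+\ell}=\frac{n}{r+k}.$$ In particular, for every $r\ge 7$ the statement "$\gamma_p^k(\mathcal{H})\le \frac{n}{r+k}$ for all $k\ge 1$ and all connected $r$-uniform hypergraphs $\mathcal{H}$ on $n\ge k+r$ vertices" is false.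
   Context: A (finite) hypergraph $\mathcal{H}=(V,E)$ is a finite set of vertices $V$ together with a set of edges $E$ that is a subset of the power set of $V$. It is $r$-uniform if every edge has exactly $r$ vertices. Two distinct vertices are adjacent (neighbors) if some edge contains both. It is connected if any two vertices are joined by a path of consecutively adjacent vertices. For $v\in V$, the closed neighborhood $N[v]$ consists of $v$ and all vertices adjacent to $v$; for $S\subseteq V$, $N[S]=\bigcup_{v\in S}N[v]$. A set $D\subseteq V$ colors vertices blue by the following process (vertices that are not blue are white). (1) Domination step: all vertices in $N[D]$ are colored blue. (2) Forcing step, applied repeatedly: given a blue vertex $v$, if there is a set of at most $k$ edges, each incident with $v$, that together contain all of $v$'s white neighbors, then these white neighbors turn blue. If iteratively applying these rules makes all vertices blue, then $D$ is a $k$-power dominating set of $\mathcal{H}$. The $k$-power domination number $\gamma_p^k(\mathcal{H})$ is the minimum cardinality of a $k$-power dominating set of $\mathcal{H}$. *)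

theory Defs
  imports Complex_Main
begin

record 'a hypergraph =
  verts :: "'a set"
  edges :: "'a set set"

definition hypergraph :: "'a hypergraph \<Rightarrow> bool" where
  "hypergraph H \<longleftrightarrow> finite (verts H) \<and> edges H \<subseteq> Pow (verts H)"

definition uniform :: "nat \<Rightarrow> 'a hypergraph \<Rightarrow> bool" where
  "uniform r H \<longleftrightarrow> (\<forall>e\<in>edges H. card e = r)"

definition adjacent :: "'a hypergraph \<Rightarrow> 'a \<Rightarrow> 'a \<Rightarrow> bool" where
  "adjacent H u v \<longleftrightarrow> u \<noteq> v \<and> (\<exists>e\<in>edges H. u \<in> e \<and> v \<in> e)"

definition connected_hypergraph :: "'a hypergraph \<Rightarrow> bool" where
  "connected_hypergraph H \<longleftrightarrow> (\<forall>u\<in>verts H. \<forall>v\<in>verts H. (adjacent H)\<^sup>*\<^sup>* u v)"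

definition closed_nbhd :: "'a hypergraph \<Rightarrow> 'a \<Rightarrow> 'a set" where
  "closed_nbhd H v = insert v {u \<in> verts H. adjacent H v u}"

definition closed_nbhd_set :: "'a hypergraph \<Rightarrow> 'a set \<Rightarrow> 'a set" where
  "closed_nbhd_set H S = (\<Union>v\<in>S. closed_nbhd H v)"

definition white_nbrs :: "'a hypergraph \<Rightarrow> 'a set \<Rightarrow> 'a \<Rightarrow> 'a set" where
  "white_nbrs H B v = {u \<in> verts H. adjacent H v u \<and> u \<notin> B}"

(* The states of the colouring process are the sets of blue vertices.  Finiteness of the
   edge set F is required explicitly because card is 0 on infinite sets. *)
inductive forcing_step :: "nat \<Rightarrow> 'a hypergraph \<Rightarrow> 'a set \<Rightarrow> 'a set \<Rightarrow> bool"
  for k :: nat and H :: "'a hypergraph" where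
  "\<lbrakk>v \<in> B; F \<subseteq> edges H; finite F; card F \<le> k; \<forall>e\<in>F. v \<in> e; white_nbrs H B v \<subseteq> \<Union>F\<rbrakk>
    \<Longrightarrow> forcing_step k H B (B \<union> white_nbrs H B v)"

definition power_dominating :: "nat \<Rightarrow> 'a hypergraph \<Rightarrow> 'a set \<Rightarrow> bool" where
  "power_dominating k H D \<longleftrightarrow>
     D \<subseteq> verts H \<and> (forcing_step k H)\<^sup>*\<^sup>* (closed_nbhd_set H D) (verts H)"

definition power_domination_number :: "nat \<Rightarrow> 'a hypergraph \<Rightarrow> nat" where
  "power_domination_number k H = Min (card ` {D. power_dominating k H D})"

definition three_block_hypergraph ::
  "nat \<Rightarrow> (nat \<Rightarrow> 'a) \<Rightarrow> (nat \<Rightarrow> 'a) \<Rightarrow> (nat \<Rightarrow> 'a) \<Rightarrow> 'a set \<Rightarrow> 'a set \<Rightarrow> 'a set \<Rightarrow> 'a set \<Rightarrow> 'a set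
    \<Rightarrow> 'a hypergraph" where
  "three_block_hypergraph k x y z A1 A2 A3 B1 B2 =
     \<lparr>verts = x ` {1..k+1} \<union> y ` {1..k+1} \<union> z ` {1..k+1} \<union> A1 \<union> A2 \<union> A3 \<union> B1 \<union> B2,
      edges = (\<Union>i\<in>{1..k+1}. {A1 \<union> B1 \<union> {x i} \<union> A2,
                               A2 \<union> B1 \<union> {z i} \<union> A3,
                               A1 \<union> B2 \<union> {y i} \<union> A3})\<rparr>"

(* sorted_wrt disjnt on a list says that its members at distinct positions are disjoint;
   pairwise disjnt on the set of the eight blocks would miss coinciding blocks. *)
definition valid_blocks ::
  "nat \<Rightarrow> nat \<Rightarrow> (nat \<Rightarrow> 'a) \<Rightarrow> (nat \<Rightarrow> 'a) \<Rightarrow> (nat \<Rightarrow> 'a) \<Rightarrow> 'a set \<Rightarrow> 'a set \<Rightarrow> 'a set \<Rightarrow> 'a set \<Rightarrow> 'a set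
    \<Rightarrow> bool" where
  "valid_blocks k l x y z A1 A2 A3 B1 B2 \<longleftrightarrow>
     inj_on x {1..k+1} \<and> inj_on y {1..k+1} \<and> inj_on z {1..k+1} \<and>
     (\<forall>A\<in>{A1, A2, A3}. finite A \<and> card A = k + 2) \<and>
     (\<forall>B\<in>{B1, B2}. finite B \<and> card B = l) \<and>
     sorted_wrt disjnt [x ` {1..k+1}, y ` {1..k+1}, z ` {1..k+1}, A1, A2, A3, B1, B2]"

end

(* No vertex lies in edges of all three types, so for every vertex v one of the blocks X, Y, Z,
   say W, consists of vertices neither equal nor adjacent to v; the domination step from {v}
   leaves all of W white. Forcing never reaches W: a vertex outside W adjacent to one member of
   W is adjacent to all k + 1 of them, and k edges cover at most k of these. *)
theory Submission
  imports Defs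
begin

section \<open>Vertex sets that forcing cannot reach\<close>

text \<open>\<open>single\<close> and \<open>twins\<close> isolate what the argument uses about a
  block, independently of the shape of the edges: \<open>single\<close> bounds how much of
  \<open>W\<close> the \<open>k\<close> edges can cover, \<open>twins\<close> makes forcing into
  \<open>W\<close> an all-or-nothing matter.\<close>

lemma forcing_step_preserves_white_block:
  assumes step: "forcing_step k H B B'"
    and W: "W \<subseteq> verts H" "card W > k"
    and single: "\<And>e. e \<in> edges H \<Longrightarrow> \<exists>w. e \<inter> W \<subseteq> {w}"
    and twins: "\<And>u w w'. u \<notin> W \<Longrightarrow> w \<in> W \<Longrightarrow> w' \<in> W \<Longrightarrow> adjacent H u w \<Longrightarrow> adjacent H u w'"
    and white: "B \<inter> W = {}"
  shows "B' \<inter> W = {}"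
  using step
proof cases
  case (1 v F)
  show ?thesis
  proof (rule ccontr)
    assume "B' \<inter> W \<noteq> {}"
    with 1 white obtain w where w: "w \<in> W" "adjacent H v w"
      unfolding white_nbrs_def by auto
    \<comment> \<open>The forcing vertex is blue while \<open>W\<close> is white, so
      \<open>twins\<close> applies to it and spreads its adjacency from \<open>w\<close> to the
      whole of \<open>W\<close>.\<close>
    have "v \<notin> W" using 1 white by auto
    with w twins have "W \<subseteq> white_nbrs H B v"
      unfolding white_nbrs_def using white W(1) by blast
    with 1 have cover: "W \<subseteq> \<Union>F" by simp
    \<comment> \<open>\<open>f\<close> sends an edge to the only vertex of \<open>W\<close> it can
      contain, with an arbitrary value if there is none; covering \<open>W\<close> thus makes
      \<open>f\<close> map \<open>F\<close> onto a superset of \<open>W\<close>.\<close>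
    from single 1 obtain f where f: "\<And>e. e \<in> F \<Longrightarrow> e \<inter> W \<subseteq> {f e}"
      by (metis subsetD)
    have "W \<subseteq> f ` F" using cover f by blast
    then have "card W \<le> card F"
      using \<open>finite F\<close> by (meson card_image_le card_mono finite_imageI le_trans)
    with 1 W show False by simp
  qed
qed

text \<open>Whiteness of \<open>W\<close> is an invariant of forcing, and \<open>card W > k\<close>
  makes \<open>W\<close> nonempty, so the all-blue state is never reached.\<close>

lemma not_power_dominating_if_white_block:
  assumes W: "W \<subseteq> verts H" "card W > k"
    and single: "\<And>e. e \<in> edges H \<Longrightarrow> \<exists>w. e \<inter> W \<subseteq> {w}"
    and twins: "\<And>u w w'. u \<notin> W \<Longrightarrow> w \<in> W \<Longrightarrow> w' \<in> W \<Longrightarrow> adjacent H u w \<Longrightarrow> adjacent H u w'"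
    and white: "closed_nbhd_set H D \<inter> W = {}"
  shows "\<not> power_dominating k H D"
proof
  assume "power_dominating k H D"
  then have "(forcing_step k H)\<^sup>*\<^sup>* (closed_nbhd_set H D) (verts H)"
    by (simp add: power_dominating_def)
  then have "verts H \<inter> W = {}"
  proof (induction rule: rtranclp_induct)
    case base
    show ?case by (fact white)
  next
    case (step B B')
    then show ?case
      by (intro forcing_step_preserves_white_block[OF step(2) W single twins])
  qed
  with W show False by (metis card.empty inf.absorb2 not_less_zero)
qed

text \<open>The vertex \<open>w i\<close> lies on one edge only, so its neighbors are exactly the
  members of \<open>C\<close>, the same set for every \<open>i\<close>. The other two families enter
  through free parameters, which lets one lemma serve X, Y and Z in turn.\<close>

lemma not_power_dominating_if_undominated_block:
  fixes w :: "nat \<Rightarrow> 'a"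
  assumes H: "hypergraph H"
    and edges: "edges H = (\<Union>i\<in>{1..k+1}. {insert (w i) C, insert (u i) C', insert (u' i) C''})"
    and inj: "inj_on w {1..k+1}"
    and disj: "w ` {1..k+1} \<inter> (C \<union> C' \<union> C'' \<union> u ` {1..k+1} \<union> u' ` {1..k+1}) = {}"
    and D: "D \<inter> (w ` {1..k+1} \<union> C) = {}"
  shows "\<not> power_dominating k H D"
proof (rule not_power_dominating_if_white_block)
  have edge: "insert (w i) C \<in> edges H" if "i \<in> {1..k+1}" for i
    using that edges by blast
  have only: "e = insert (w i) C" if e: "e \<in> edges H" and i: "i \<in> {1..k+1}" and "w i \<in> e" for e i
  proof -
    have "w i \<in> w ` {1..k+1}" using i by (rule imageI)
    then have "w i \<notin> C'" "w i \<notin> C''" "w i \<notin> u ` {1..k+1}" "w i \<notin> u' ` {1..k+1}" "w i \<notin> C"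
      using disj unfolding disjoint_iff Un_iff by metis+
    note out = this
    from e obtain j where j: "j \<in> {1..k+1}"
      and ej: "e = insert (w j) C \<or> e = insert (u j) C' \<or> e = insert (u' j) C''"
      unfolding edges by auto
    have "w i \<noteq> u j" "w i \<noteq> u' j"
      using out(3,4) imageI[OF j, of u] imageI[OF j, of u'] by auto
    with ej out \<open>w i \<in> e\<close> have "e = insert (w j) C \<and> w i = w j" by auto
    then show ?thesis by simp
  qed
  show "w ` {1..k+1} \<subseteq> verts H" using edge H unfolding hypergraph_def by blast
  show "card (w ` {1..k+1}) > k" using inj by (simp add: card_image)
  show "\<exists>a. e \<inter> w ` {1..k+1} \<subseteq> {a}" if "e \<in> edges H" for e
  proof (cases "e \<inter> w ` {1..k+1} = {}")
    case False
    then obtain i where "i \<in> {1..k+1}" "w i \<in> e"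
      unfolding ex_in_conv[symmetric] Int_iff image_iff by metis
    with only that have "e = insert (w i) C" by metis
    moreover have "C \<inter> w ` {1..k+1} = {}" using disj by blast
    ultimately have "e \<inter> w ` {1..k+1} \<subseteq> {w i}" by blast
    then show ?thesis by (rule exI)
  qed simp
  show "adjacent H v b'"
    if v: "v \<notin> w ` {1..k+1}" and b: "b \<in> w ` {1..k+1}" and b': "b' \<in> w ` {1..k+1}"
      and "adjacent H v b" for v b b'
  proof -
    from b b' obtain i j where i: "i \<in> {1..k+1}" "b = w i" and j: "j \<in> {1..k+1}" "b' = w j"
      by blast
    from \<open>adjacent H v b\<close> i(2) obtain e where "e \<in> edges H" "v \<in> e" "w i \<in> e"
      unfolding adjacent_def by auto
    \<comment> \<open>The edge joining \<open>v\<close> to \<open>b\<close> is the one through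
      \<open>b\<close>; outside the block it consists of \<open>C\<close>, which every edge of this
      family contains.\<close>
    with only[of e i] i v b have "v \<in> C" by (metis insert_iff)
    moreover have "v \<noteq> b'" using v b' by blast
    ultimately show ?thesis
      using edge[OF j(1)] j(2) unfolding adjacent_def by blast
  qed
  show "closed_nbhd_set H D \<inter> w ` {1..k+1} = {}"
  proof (rule ccontr)
    assume "closed_nbhd_set H D \<inter> w ` {1..k+1} \<noteq> {}"
    then obtain d i where d: "d \<in> D" "i \<in> {1..k+1}" "w i \<in> closed_nbhd H d"
      unfolding closed_nbhd_set_def by blast
    \<comment> \<open>A closed neighborhood contains its center, so that case is excluded before
      adjacency is used.\<close>
    with D have "w i \<noteq> d" by blast
    with d obtain e where "e \<in> edges H" "d \<in> e" "w i \<in> e"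
      unfolding closed_nbhd_def adjacent_def by blast
    with only[of e i] d \<open>w i \<noteq> d\<close> have "d \<in> C" by (metis insert_iff)
    with d D show False by blast
  qed
qed

section \<open>Disjointness, edge sizes and the number of vertices\<close>

text \<open>All 28 pairs are listed in the order X, Y, Z, A1, A2, A3, B1, B2, the earlier block on
  the left; later proofs select facts by position and reverse them where needed.\<close>

lemma valid_blocks_disjoint:
  assumes "valid_blocks k l x y z A1 A2 A3 B1 B2"
  defines "X \<equiv> x ` {1..k+1}" and "Y \<equiv> y ` {1..k+1}" and "Z \<equiv> z ` {1..k+1}"
  shows "X \<inter> Y = {}" "X \<inter> Z = {}" "X \<inter> A1 = {}" "X \<inter> A2 = {}" "X \<inter> A3 = {}" "X \<inter> B1 = {}" "X \<inter> B2 = {}"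
    "Y \<inter> Z = {}" "Y \<inter> A1 = {}" "Y \<inter> A2 = {}" "Y \<inter> A3 = {}" "Y \<inter> B1 = {}" "Y \<inter> B2 = {}"
    "Z \<inter> A1 = {}" "Z \<inter> A2 = {}" "Z \<inter> A3 = {}" "Z \<inter> B1 = {}" "Z \<inter> B2 = {}"
    "A1 \<inter> A2 = {}" "A1 \<inter> A3 = {}" "A1 \<inter> B1 = {}" "A1 \<inter> B2 = {}"
    "A2 \<inter> A3 = {}" "A2 \<inter> B1 = {}" "A2 \<inter> B2 = {}"
    "A3 \<inter> B1 = {}" "A3 \<inter> B2 = {}" "B1 \<inter> B2 = {}"
  using assms unfolding valid_blocks_def disjnt_def by simp_all

lemma valid_blocks_card:
  assumes "valid_blocks k l x y z A1 A2 A3 B1 B2"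
  shows "inj_on x {1..k+1}" "inj_on y {1..k+1}" "inj_on z {1..k+1}"
    "finite A1" "finite A2" "finite A3" "finite B1" "finite B2"
    "card A1 = k + 2" "card A2 = k + 2" "card A3 = k + 2" "card B1 = l" "card B2 = l"
  using assms unfolding valid_blocks_def by simp_all

lemma three_block_hypergraph_finite:
  assumes "valid_blocks k l x y z A1 A2 A3 B1 B2"
  shows "hypergraph (three_block_hypergraph k x y z A1 A2 A3 B1 B2)"
  using valid_blocks_card[OF assms] unfolding hypergraph_def three_block_hypergraph_def by auto

lemma three_block_hypergraph_uniform:
  assumes "valid_blocks k l x y z A1 A2 A3 B1 B2"
  shows "uniform (5 + 2 * k + l) (three_block_hypergraph k x y z A1 A2 A3 B1 B2)"
    (is "uniform _ ?H")
proof -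
  note c = valid_blocks_card[OF assms] and d = valid_blocks_disjoint[OF assms]
  \<comment> \<open>All three edge types have this shape, with \<open>P\<close> and \<open>R\<close>
    among the A blocks and \<open>Q\<close> a B block, giving 2(k + 2) + l + 1 vertices.\<close>
  have card_edge: "card (P \<union> Q \<union> {v} \<union> R) = 5 + 2 * k + l"
    if "finite P" "finite Q" "finite R" "card P = k + 2" "card Q = l" "card R = k + 2"
      "P \<inter> Q = {}" "P \<inter> R = {}" "Q \<inter> R = {}" "v \<notin> P" "v \<notin> Q" "v \<notin> R" for P Q R :: "'a set" and v
  proof -
    have "P \<union> Q \<union> {v} \<union> R = insert v (P \<union> Q \<union> R)" by blast
    then show ?thesis using that by (simp add: card_Un_disjoint Int_Un_distrib2)
  qed
  have "card e = 5 + 2 * k + l" if "e \<in> edges ?H" for e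
  proof -
    from that obtain i where i: "i \<in> {1..k+1}"
      and e: "e = A1 \<union> B1 \<union> {x i} \<union> A2 \<or> e = A2 \<union> B1 \<union> {z i} \<union> A3 \<or> e = A1 \<union> B2 \<union> {y i} \<union> A3"
      unfolding three_block_hypergraph_def by auto
    note im = imageI[OF i, of x] imageI[OF i, of y] imageI[OF i, of z]
    \<comment> \<open>Listed facts settle most side conditions here and below; what remains is that
      the extra vertex avoids the three blocks, and the one disjointness listed in the opposite
      orientation.\<close>
    have "card (A1 \<union> B1 \<union> {x i} \<union> A2) = 5 + 2 * k + l"
      by (rule card_edge; (fact c d)?) (use im d(3,4,6,24) in blast)+
    moreover have "card (A2 \<union> B1 \<union> {z i} \<union> A3) = 5 + 2 * k + l"
      by (rule card_edge; (fact c d)?) (use im d(15-17,26) in blast)+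
    moreover have "card (A1 \<union> B2 \<union> {y i} \<union> A3) = 5 + 2 * k + l"
      by (rule card_edge; (fact c d)?) (use im d(9,11,13,27) in blast)+
    ultimately show ?thesis using e by metis
  qed
  then show ?thesis by (simp add: uniform_def)
qed

lemma card_verts_three_block_hypergraph:
  assumes "valid_blocks k l x y z A1 A2 A3 B1 B2"
  shows "card (verts (three_block_hypergraph k x y z A1 A2 A3 B1 B2)) = 9 + 6 * k + 2 * l"
proof -
  note c = valid_blocks_card[OF assms]
  define X Y Z where "X = x ` {1..k+1}" and "Y = y ` {1..k+1}" and "Z = z ` {1..k+1}"
  note d = valid_blocks_disjoint[OF assms, folded X_def Y_def Z_def]
  have XYZ: "card X = k + 1" "card Y = k + 1" "card Z = k + 1" "finite X" "finite Y" "finite Z"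
    using c(1-3) by (simp_all add: X_def Y_def Z_def card_image)
  have "verts (three_block_hypergraph k x y z A1 A2 A3 B1 B2) = X \<union> Y \<union> Z \<union> A1 \<union> A2 \<union> A3 \<union> B1 \<union> B2"
    by (simp add: three_block_hypergraph_def X_def Y_def Z_def)
  also have "card \<dots> = card X + card Y + card Z + card A1 + card A2 + card A3 + card B1 + card B2"
    by (simp only: card_Un_disjoint Int_Un_distrib2 finite_Un c(4-8) XYZ(4-6) d Un_empty_left simp_thms)
  finally show ?thesis using XYZ c by simp
qed

section \<open>The lower bound on the power domination number\<close>

text \<open>This supplies a power dominating set, so that the minimum defining the power domination
  number is taken over a nonempty set.\<close>

lemma power_dominating_verts: "power_dominating k H (verts H)"
proof -
  have "closed_nbhd_set H (verts H) = verts H"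
    unfolding closed_nbhd_set_def closed_nbhd_def by auto
  then show ?thesis by (simp add: power_dominating_def)
qed

lemma power_domination_number_ge:
  assumes "finite (verts H)" "\<And>D. power_dominating k H D \<Longrightarrow> m \<le> card D"
  shows "m \<le> power_domination_number k H"
proof -
  have "{D. power_dominating k H D} \<subseteq> Pow (verts H)"
    by (auto simp: power_dominating_def)
  with assms(1) have "finite {D. power_dominating k H D}"
    by (meson finite_Pow_iff finite_subset)
  moreover have "{D. power_dominating k H D} \<noteq> {}"
    using power_dominating_verts by blast
  ultimately show ?thesis
    unfolding power_domination_number_def using assms(2) by (subst Min_ge_iff) auto
qed

text \<open>The form \<open>D \<subseteq> {v}\<close> treats the empty set and singletons together,
  that is, all sets of size below 2.\<close>

lemma three_block_hypergraph_singleton_not_power_dominating: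
  assumes "valid_blocks k l x y z A1 A2 A3 B1 B2" "D \<subseteq> {v}"
  shows "\<not> power_dominating k (three_block_hypergraph k x y z A1 A2 A3 B1 B2) D"
    (is "\<not> power_dominating k ?H D")
proof -
  note H = three_block_hypergraph_finite[OF assms(1)]
  note c = valid_blocks_card[OF assms(1)] and d = valid_blocks_disjoint[OF assms(1)]
  define Cx Cy Cz where "Cx = A1 \<union> B1 \<union> A2" and "Cy = A1 \<union> B2 \<union> A3" and "Cz = A2 \<union> B1 \<union> A3"
  note C_defs = Cx_def Cy_def Cz_def
  have edges: "edges ?H = (\<Union>i\<in>{1..k+1}. {insert (x i) Cx, insert (z i) Cz, insert (y i) Cy})"
    by (simp add: three_block_hypergraph_def C_defs)
  \<comment> \<open>Each block misses some edge type: A1 is absent from \<open>Cz\<close>, A2 and B1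
    from \<open>Cy\<close>, A3 and B2 from \<open>Cx\<close>, and a vertex of X, Y or Z occurs in
    one type only.\<close>
  have "v \<notin> x ` {1..k+1} \<union> Cx \<or> v \<notin> z ` {1..k+1} \<union> Cz \<or> v \<notin> y ` {1..k+1} \<union> Cy"
    using d[THEN equals0D, of v] unfolding C_defs Un_iff Int_iff by argo
  then consider "D \<inter> (x ` {1..k+1} \<union> Cx) = {}" | "D \<inter> (z ` {1..k+1} \<union> Cz) = {}"
    | "D \<inter> (y ` {1..k+1} \<union> Cy) = {}"
    using assms(2) by blast
  then show ?thesis
  proof cases
    case 1
    show ?thesis
    proof (rule not_power_dominating_if_undominated_block[OF H edges c(1) _ 1])
      show "x ` {1..k+1} \<inter> (Cx \<union> Cz \<union> Cy \<union> z ` {1..k+1} \<union> y ` {1..k+1}) = {}"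
        unfolding C_defs Int_Un_distrib d by (simp only: Un_empty_left)
    qed
  next
    case 2
    \<comment> \<open>The undominated family has to come first to match the general lemma.\<close>
    have edges': "edges ?H = (\<Union>i\<in>{1..k+1}. {insert (z i) Cz, insert (x i) Cx, insert (y i) Cy})"
      unfolding edges by (simp only: insert_commute)
    show ?thesis
    proof (rule not_power_dominating_if_undominated_block[OF H edges' c(3) _ 2])
      show "z ` {1..k+1} \<inter> (Cz \<union> Cx \<union> Cy \<union> x ` {1..k+1} \<union> y ` {1..k+1}) = {}"
        unfolding C_defs Int_Un_distrib d d(2,8)[THEN Int_commute[THEN trans]]
        by (simp only: Un_empty_left)
    qed
  next
    case 3
    have edges': "edges ?H = (\<Union>i\<in>{1..k+1}. {insert (y i) Cy, insert (x i) Cx, insert (z i) Cz})"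
      unfolding edges by (simp only: insert_commute)
    show ?thesis
    proof (rule not_power_dominating_if_undominated_block[OF H edges' c(2) _ 3])
      show "y ` {1..k+1} \<inter> (Cy \<union> Cx \<union> Cz \<union> x ` {1..k+1} \<union> z ` {1..k+1}) = {}"
        unfolding C_defs Int_Un_distrib d d(1)[THEN Int_commute[THEN trans]]
        by (simp only: Un_empty_left)
    qed
  qed
qed

lemma three_block_hypergraph_power_domination_number:
  assumes "valid_blocks k l x y z A1 A2 A3 B1 B2"
  shows "power_domination_number k (three_block_hypergraph k x y z A1 A2 A3 B1 B2) \<ge> 2"
    (is "power_domination_number k ?H \<ge> 2")
proof (rule power_domination_number_ge)
  show fin: "finite (verts ?H)"
    using three_block_hypergraph_finite[OF assms] by (simp add: hypergraph_def)
  fix D assume pd: "power_dominating k ?H D"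
  then have "finite D" using fin by (auto simp: power_dominating_def intro: finite_subset)
  show "2 \<le> card D"
  proof (rule ccontr)
    assume "\<not> 2 \<le> card D"
    then have "card D = 0 \<or> card D = 1" by linarith
    then have "\<exists>v. D \<subseteq> {v}"
      using \<open>finite D\<close> by (metis card_0_eq card_1_singletonE empty_subsetI order_refl)
    with pd three_block_hypergraph_singleton_not_power_dominating[OF assms] show False by blast
  qed
qed

section \<open>Connectedness\<close>

lemma reachable_if_common_edge:
  assumes "e \<in> edges H" "u \<in> e" "v \<in> e"
  shows "(adjacent H)\<^sup>*\<^sup>* u v"
  using assms by (cases "u = v") (auto simp: adjacent_def intro!: r_into_rtranclp)

text \<open>Every vertex reaches a fixed vertex of A1: edges of the X and Y types contain A1, and
  those of the Z type contain A3, which any edge of the Y type joins to A1.\<close>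

lemma three_block_hypergraph_connected:
  assumes "valid_blocks k l x y z A1 A2 A3 B1 B2"
  shows "connected_hypergraph (three_block_hypergraph k x y z A1 A2 A3 B1 B2)"
    (is "connected_hypergraph ?H")
proof -
  from valid_blocks_card[OF assms] have "A1 \<noteq> {}" "A3 \<noteq> {}" by force+
  then obtain a b where a: "a \<in> A1" and b: "b \<in> A3" by blast
  have edges: "A1 \<union> B1 \<union> {x i} \<union> A2 \<in> edges ?H" "A2 \<union> B1 \<union> {z i} \<union> A3 \<in> edges ?H"
    "A1 \<union> B2 \<union> {y i} \<union> A3 \<in> edges ?H" if "i \<in> {1..k+1}" for i
    using that unfolding three_block_hypergraph_def by auto
  have ab: "(adjacent ?H)\<^sup>*\<^sup>* b a"
    using edges(3)[of 1] a b by (auto intro: reachable_if_common_edge)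
  have to_a: "(adjacent ?H)\<^sup>*\<^sup>* u a" if u: "u \<in> verts ?H" for u
  proof -
    from u consider i where "i \<in> {1..k+1}" "u \<in> A1 \<union> B1 \<union> {x i} \<union> A2"
      | i where "i \<in> {1..k+1}" "u \<in> A1 \<union> B2 \<union> {y i} \<union> A3"
      | i where "i \<in> {1..k+1}" "u \<in> A2 \<union> B1 \<union> {z i} \<union> A3"
    proof -
      \<comment> \<open>Vertices of the A and B blocks carry no index, so an edge through them is
        chosen with index 1.\<close>
      have "1 \<in> {1..k+1}" by simp
      then show thesis
        using u that unfolding three_block_hypergraph_def by auto
    qed
    then show ?thesis
    proof cases
      case 1
      then show ?thesis using reachable_if_common_edge[OF edges(1)] a by blast
    next
      case 2
      then show ?thesis using reachable_if_common_edge[OF edges(3)] a by blast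
    next
      case 3
      then have "(adjacent ?H)\<^sup>*\<^sup>* u b" using reachable_if_common_edge[OF edges(2)] b by blast
      with ab show ?thesis by simp
    qed
  qed
  have "symp (adjacent ?H)" by (auto simp: symp_def adjacent_def)
  then have "symp (adjacent ?H)\<^sup>*\<^sup>*" by (rule symp_rtranclp)
  with to_a show ?thesis
    unfolding connected_hypergraph_def by (meson rtranclp_trans sympD)
qed

section \<open>A concrete instance and the ratio\<close>

text \<open>Without an instance the claims about valid blocks could be vacuous. X, Y and Z are put
  in consecutive windows of length k + 2, each skipping offset 0 as indices start at 1; three A
  intervals of length k + 2 and two B intervals of length l follow.\<close>

lemma ex_valid_blocks_nat:
  "\<exists>(x :: nat \<Rightarrow> nat) y z A1 A2 A3 B1 B2. valid_blocks k l x y z A1 A2 A3 B1 B2"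
proof -
  let ?s = "3 * (k + 2)"
  let ?t = "6 * (k + 2)"
  have "valid_blocks k l (\<lambda>i. i) (\<lambda>i. (k + 2) + i) (\<lambda>i. 2 * (k + 2) + i)
    {?s..<?s + (k + 2)} {?s + (k + 2)..<?s + 2 * (k + 2)} {?s + 2 * (k + 2)..<?t}
    {?t..<?t + l} {?t + l..<?t + 2 * l}"
    unfolding valid_blocks_def disjnt_def by (auto simp: inj_on_def)
  then show ?thesis by blast
qed

text \<open>Twice the denominator exceeds the numerator by exactly 1.\<close>

lemma three_block_ratio_less_two:
  "(9 + 6 * real k + 2 * real l) / (5 + 3 * real k + real l) < 2"
proof -
  have "0 < 5 + 3 * real k + real l" by (intro add_pos_nonneg) auto
  then show ?thesis by (simp add: divide_less_eq)
qed

theorem mainTheorem3: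
  shows "(\<forall>(k::nat) (l::nat) (x::nat \<Rightarrow> 'a) y z A1 A2 A3 B1 B2 H r n.
            k \<ge> 1 \<longrightarrow>
            valid_blocks k l x y z A1 A2 A3 B1 B2 \<longrightarrow>
            H = three_block_hypergraph k x y z A1 A2 A3 B1 B2 \<longrightarrow>
            r = 5 + 2 * k + l \<longrightarrow>
            n = card (verts H) \<longrightarrow>
              hypergraph H \<and> uniform r H \<and> n = 9 + 6 * k + 2 * l \<and>
              power_domination_number k H \<ge> 2 \<and>
              (2::real) > (9 + 6 * real k + 2 * real l) / (5 + 3 * real k + real l) \<and>
              (9 + 6 * real k + 2 * real l) / (5 + 3 * real k + real l) = real n / real (r + k))
       \<and> (\<forall>r\<ge>(7::nat).
            \<not> (\<forall>k\<ge>(1::nat). \<forall>H :: nat hypergraph.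
                  hypergraph H \<and> connected_hypergraph H \<and> uniform r H \<and> card (verts H) \<ge> k + r \<longrightarrow>
                  real (power_domination_number k H) \<le> real (card (verts H)) / real (r + k)))"
proof (intro conjI allI impI)
  fix k l :: nat and x y z :: "nat \<Rightarrow> 'a" and A1 A2 A3 B1 B2 H r n
  assume v: "valid_blocks k l x y z A1 A2 A3 B1 B2"
    and H: "H = three_block_hypergraph k x y z A1 A2 A3 B1 B2"
    and r: "r = 5 + 2 * k + l" and n: "n = card (verts H)"
  show "hypergraph H" using three_block_hypergraph_finite[OF v] H by simp
  show "uniform r H" using three_block_hypergraph_uniform[OF v] H r by simp
  show n': "n = 9 + 6 * k + 2 * l" using card_verts_three_block_hypergraph[OF v] H n by simp
  show "power_domination_number k H \<ge> 2"
    using three_block_hypergraph_power_domination_number[OF v] H by simp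
  show "(2::real) > (9 + 6 * real k + 2 * real l) / (5 + 3 * real k + real l)"
    by (rule three_block_ratio_less_two)
  show "(9 + 6 * real k + 2 * real l) / (5 + 3 * real k + real l) = real n / real (r + k)"
    using n' r by (simp add: algebra_simps)
next
  fix r :: nat
  assume "r \<ge> 7"
  \<comment> \<open>A single \<open>k\<close> refutes the statement. With \<open>k = 1\<close> the
    uniformity is 7 + l, so every \<open>r \<ge> 7\<close> is attained by taking l = r - 7.\<close>
  then obtain l where r: "r = 5 + 2 * 1 + l" using le_Suc_ex[of 7 r] by auto
  obtain x y z :: "nat \<Rightarrow> nat" and A1 A2 A3 B1 B2
    where v: "valid_blocks 1 l x y z A1 A2 A3 B1 B2"
    using ex_valid_blocks_nat by blast
  define H where "H = three_block_hypergraph 1 x y z A1 A2 A3 B1 B2"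
  have n: "card (verts H) = 9 + 6 * 1 + 2 * l"
    unfolding H_def by (rule card_verts_three_block_hypergraph[OF v])
  have "hypergraph H" "connected_hypergraph H" "uniform r H"
    unfolding H_def r
    by (rule three_block_hypergraph_finite[OF v] three_block_hypergraph_connected[OF v]
        three_block_hypergraph_uniform[OF v])+
  moreover have "card (verts H) \<ge> 1 + r" using n r by simp
  moreover have "real (card (verts H)) / real (r + 1) < real (power_domination_number 1 H)"
  proof -
    have "real (card (verts H)) / real (r + 1) < 2"
      using three_block_ratio_less_two[of 1 l] n r by (simp add: algebra_simps)
    also have "2 \<le> real (power_domination_number 1 H)"
      using three_block_hypergraph_power_domination_number[OF v] by (simp add: H_def)
    finally show ?thesis .
  qed
  ultimately show "\<not> (\<forall>k\<ge>(1::nat). \<forall>H :: nat hypergraph.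
                  hypergraph H \<and> connected_hypergraph H \<and> uniform r H \<and> card (verts H) \<ge> k + r \<longrightarrow>
                  real (power_domination_number k H) \<le> real (card (verts H)) / real (r + k))"
    by (metis leD order_refl)
qed

end
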